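(* Assume $s=d$. Let $R^*$ have the distribution of $R$, independent of $X^{(n)}$, and for $\alpha\ge0$ define $$D^{\prime,(\alpha)}_{\mathsf{out},n}=\sum_{(\xi,r)\in X^{(n)}}|\xi|^\alpha 1\{((o,R^* ),(\xi,r))\text{ is an edge in }G^\prime(\{(o,R^* )\}\cup X^{(n)})\},$$ where $|\xi|={\rm d}_{\mathbb{T}_n}(\xi,o)$. Then $\mathbb{E}D^{\prime,(0)}_{\mathsf{out},n}\in O(1)$ as $n\to\infty$, and if $\alpha>0$ there exists $\delta>0$ such that $\mathbb{E}D^{\prime,(\alpha)}_{\mathsf{out},n}\in O(n^{\alpha-\delta})$.
   Context: Fix an integer $d\ge2$. For $n\ge1$, $\mathbb{T}_n$ is the torus obtained from $[-n/2,n/2]^d$ by identifying opposite faces, with toroidal distance ${\rm d}_{\mathbb{T}_n}$ and $B^{\mathbb{T}_n}_r(\xi)=\{\eta\in\mathbb{T}_n:{\rm d}_{\mathbb{T}_n}(\xi,\eta)\le r\}$. $R$ is a nonnegative random variable with absolutely continuous distribution such that $\lim_{h\to\infty}h^s\mathbb{P}(R>h)=\beta$ for some $\beta,s\in(0,\infty)$. $X^{(n)}$ is a homogeneous Poisson point process of intensity $1$ on $\mathbb{T}_n$, each point independently marked with a mark in $[0,\infty)$ distributed as $R$ (points written $(\xi,r)$). For a finite set $\varphi\subset\mathbb{T}_n\times[0,\infty)$, the thinned scale-free Gilbert graph $G^\prime(\varphi)$ has vertex set $\varphi$ and a directed edge from $(\xi,r)\in\varphi$ to $(\eta,t)\in\varphi$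 iff $(\eta,t)\in B^{\mathbb{T}_n}_r(\xi)\times[0,r)$ and there is no $(\zeta,w)\in\varphi\cap(B^{\mathbb{T}_n}_r(\xi)\times(t,r))$ with $\eta\in B^{\mathbb{T}_n}_w(\zeta)$. *)

theory Defs
  imports "HOL-Probability.Probability"
begin

text \<open>Torus T_n: points represented by vectors in the box [-n/2,n/2)^d.
  One-dimensional toroidal distance and the toroidal (Euclidean) distance.\<close>

definition tor1 :: "real \<Rightarrow> real \<Rightarrow> real" where
  "tor1 L t = \<bar>t - L * of_int (round (t / L))\<bar>"

definition tdist :: "nat \<Rightarrow> real^'d \<Rightarrow> real^'d \<Rightarrow> real" where
  "tdist n x y = sqrt (\<Sum>i\<in>UNIV. (tor1 (real n) (x $ i - y $ i))\<^sup>2)"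

definition tbox :: "nat \<Rightarrow> (real^'d) set" where
  "tbox n = {x. \<forall>i. - real n / 2 \<le> x $ i \<and> x $ i < real n / 2}"

definition thin_edge :: "nat \<Rightarrow> ((real^'d) \<times> real) set \<Rightarrow> (real^'d) \<times> real \<Rightarrow> (real^'d) \<times> real \<Rightarrow> bool" where
  "thin_edge n phi p q \<longleftrightarrow>
     p \<in> phi \<and> q \<in> phi \<and>
     tdist n (fst p) (fst q) \<le> snd p \<and> 0 \<le> snd q \<and> snd q < snd p \<and>
     \<not> (\<exists>z\<in>phi. tdist n (fst p) (fst z) \<le> snd p \<and> snd q < snd z \<and> snd z < snd p
              \<and> tdist n (fst z) (fst q) \<le> snd z)"

definition pw :: "real \<Rightarrow> real \<Rightarrow> real" where
  "pw x a = (if a = 0 then 1 else x powr a)"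

definition Dout :: "nat \<Rightarrow> real \<Rightarrow> real \<Rightarrow> ((real^'d) \<times> real) list \<Rightarrow> real" where
  "Dout n a rs xs =
     (\<Sum>i<length xs. pw (tdist n (fst (xs ! i)) 0) a *
        (if thin_edge n (insert (0, rs) (set xs)) (0, rs) (xs ! i) then 1 else 0))"

definition markM :: "nat \<Rightarrow> real measure \<Rightarrow> ((real^'d) \<times> real) measure" where
  "markM n nu = restrict_space lborel (tbox n) \<Otimes>\<^sub>M nu"

text \<open>Expectation of a nonnegative functional F of the Poisson process X^(n) of intensity 1
  on T_n (volume n^d) with i.i.d. marks of law nu: given N = k ~ Poisson(n^d) the points are
  i.i.d. uniform, so the law has Janossy densities exp(-n^d)/k! w.r.t. Lebesgue measure.\<close>

definition ppp_expect :: "nat \<Rightarrow> real measure \<Rightarrow> (((real^'d) \<times> real) list \<Rightarrow> real) \<Rightarrow> ennreal" where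
  "ppp_expect n nu F =
     (\<Sum>k. ennreal (exp (- (real n ^ CARD('d))) / fact k) *
        (\<integral>\<^sup>+ f. ennreal (F (map f [0..<k])) \<partial>(\<Pi>\<^sub>M j\<in>{..<k}. markM n nu)))"

definition EDout :: "'d::finite itself \<Rightarrow> real measure \<Rightarrow> real \<Rightarrow> nat \<Rightarrow> ennreal" where
  "EDout (_ :: 'd itself) nu a n = (\<integral>\<^sup>+ rs. ppp_expect n nu (\<lambda>xs::((real^'d) \<times> real) list. Dout n a rs xs) \<partial>nu)"

end

theory Submission
  imports Defs
begin

text \<open>
  By the Mecke formula the expected weighted outdegree, given \<open>R\<^sup>* = R\<close>, is the integral of
  \<open>|x|\<^sup>\<alpha> exp (- \<mu>(x, t))\<close> over the points \<open>x\<close> within distance \<open>R\<close> of the origin and the marks \<open>t < R\<close>, where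
  \<open>\<mu>(x, t)\<close> is the mean number of points that remove the edge to \<open>(x, t)\<close>. A mark
  \<open>w\<close> in \<open>(t, R)\<close> with \<open>w \<le> n\<close> has a set of removing positions of volume of order \<open>w\<^sup>d\<close>, while marks in
  \<open>(h, 2h]\<close> have probability of order \<open>h\<^sup>-\<^sup>d\<close>; so every dyadic scale between \<open>t\<close> and \<open>min R n\<close> contributes at least a
  constant to \<open>\<mu>(x, t)\<close>, and \<open>exp (- \<mu>(x, t))\<close> is at most of order \<open>(max t 1 / min R n)\<^sup>\<gamma>\<close> for every small
  \<open>\<gamma> > 0\<close>. Integrating out \<open>x\<close> leaves \<open>E[(max R 1)\<^sup>\<gamma>] E[(min R n)\<^sup>d\<^sup>+\<^sup>\<alpha>\<^sup>-\<^sup>\<gamma>]\<close>, and the tail of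
  \<open>R\<close> makes all moments of order less than \<open>d\<close> finite.
\<close>

lemma powr_add_real:
  fixes x :: real
  assumes "0 < x"
  shows "x powr (a + b) = x powr a * x powr b"
proof -
  have "x powr c = exp (ln x * c)" for c
    using exp_powr_real[of "ln x" c] assms by (simp only: exp_ln)
  then show ?thesis by (simp only: distrib_left exp_add)
qed

subsection \<open>Dyadic estimates for the mark distribution\<close>

text \<open>Choosing the least index that satisfies the upper bound yields the lower bound by
  minimality. The alternative \<open>J = 0\<close> is for \<open>b\<close> of at most
  \<open>2 * a\<close>, where the lower bound may fail.\<close>

lemma dyadic_index:
  fixes a b :: real
  assumes "0 < a"
  obtains J :: nat where "b \<le> 2 ^ (J + 1) * a" "J = 0 \<or> 2 ^ J * a < b"
proof -
  obtain m :: nat where "b / a < 2 ^ m" using real_arch_pow[of 2] by auto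
  then have "b \<le> 2 ^ m * a" using assms by (simp add: field_simps)
  also have "\<dots> \<le> 2 ^ (m + 1) * a" using assms by simp
  finally have ex: "b \<le> 2 ^ (m + 1) * a" .
  define J where "J = (LEAST J. b \<le> 2 ^ (J + 1) * a)"
  have 1: "b \<le> 2 ^ (J + 1) * a" unfolding J_def using ex by (rule LeastI)
  have 2: "J = 0 \<or> 2 ^ J * a < b"
  proof (cases J)
    case (Suc i)
    then have "\<not> b \<le> 2 ^ (i + 1) * a" unfolding J_def by (intro not_less_Least) auto
    then show ?thesis using Suc by simp
  qed simp
  from 1 2 show ?thesis by (rule that)
qed

text \<open>From one dyadic scale to the next the power grows by \<open>2 powr p\<close> while the
  tail bound shrinks by \<open>2 ^ d\<close>. For \<open>p < d\<close> the expectation is therefore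
  dominated by a geometric series.\<close>

lemma moment_finite_of_tail_bound:
  fixes nu :: "real measure" and d :: nat and p K h0 :: real
  assumes "prob_space nu" and sets[measurable_cong]: "sets nu = sets borel" and h0: "0 < h0"
    and tail: "\<And>h. h0 \<le> h \<Longrightarrow> h ^ d * measure nu {h<..} \<le> K"
    and p: "0 \<le> p" "p < real d"
  shows "(\<integral>\<^sup>+ r. ennreal (max r h0 powr p) \<partial>nu) < \<infinity>"
proof -
  interpret prob_space nu by fact
  let ?c = "\<lambda>j::nat. (2 ^ (j + 1) * h0) powr p"
  have pt: "ennreal (max r h0 powr p) \<le>
      ennreal (h0 powr p) + (\<Sum>j. ennreal (?c j) * indicator {2 ^ j * h0<..} r)" for r
  proof (cases "r \<le> h0")
    case False
    obtain J where J: "r \<le> 2 ^ (J + 1) * h0" "J = 0 \<or> 2 ^ J * h0 < r"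
      using dyadic_index[OF h0] by blast
    \<comment> \<open>For \<open>J = 0\<close> the indicator is one because this case has
      \<open>h0 < r\<close>.\<close>
    have "ennreal (max r h0 powr p) \<le> ennreal (?c J) * indicator {2 ^ J * h0<..} r"
      using J False h0 p by (auto intro!: ennreal_leI powr_mono2)
    also have "\<dots> \<le> (\<Sum>j. ennreal (?c j) * indicator {2 ^ j * h0<..} r)"
      using sum_le_suminf[of "\<lambda>j. ennreal (?c j) * indicator {2 ^ j * h0<..} r" "{J}"]
      by (simp del: sum_mult_indicator)
    finally show ?thesis by (simp add: add_increasing)
  qed (auto intro!: add_increasing2 simp: max_def ennreal_leI)
  define q where "q = 2 powr p / (2::real) ^ d"
  have "2 powr p < (2::real) powr real d" using p by (intro powr_less_mono) auto
  then have q: "0 < q" "q < 1" by (simp_all add: q_def powr_realpow)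
  have bound: "?c j * measure nu {2 ^ j * h0<..} \<le> 2 powr p * h0 powr p * (K / h0 ^ d) * q ^ j" for j
  proof -
    have "?c j = (2 powr real (j + 1)) powr p * h0 powr p"
      by (simp only: powr_mult powr_realpow zero_less_numeral)
    also have "(2 powr real (j + 1)) powr p = (2 powr p) ^ (j + 1)"
      by (subst powr_powr_swap, rule powr_realpow) simp
    finally have c_eq: "?c j = (2 powr p) ^ (j + 1) * h0 powr p" .
    have "h0 \<le> 2 ^ j * h0" using h0 by simp
    from tail[OF this] have "measure nu {2 ^ j * h0<..} \<le> K / (2 ^ j * h0) ^ d"
      using h0 by (simp add: field_simps)
    then have "?c j * measure nu {2 ^ j * h0<..} \<le> ?c j * (K / (2 ^ j * h0) ^ d)"
      by (intro mult_left_mono) auto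
    also have "?c j * (K / (2 ^ j * h0) ^ d) =
        2 powr p * h0 powr p * (K / h0 ^ d) * ((2 powr p) ^ j / (2 ^ d) ^ j)"
      unfolding c_eq by (simp add: power_mult_distrib power_mult[symmetric] mult.commute field_simps)
    also have "(2 powr p) ^ j / (2 ^ d) ^ j = q ^ j"
      by (simp add: q_def power_divide)
    finally show ?thesis .
  qed
  \<comment> \<open>Nonnegativity of \<open>K\<close> is read off from the tail bound at
    \<open>h0\<close>; it makes the terms of the geometric series nonnegative.\<close>
  have "0 \<le> h0 ^ d * measure nu {h0<..}" using h0 by (intro mult_nonneg_nonneg) auto
  with tail[of h0] have K: "0 \<le> K" by linarith
  have "(\<integral>\<^sup>+ r. ennreal (max r h0 powr p) \<partial>nu) \<le>
    (\<integral>\<^sup>+ r. ennreal (h0 powr p) + (\<Sum>j. ennreal (?c j) * indicator {2 ^ j * h0<..} r) \<partial>nu)"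
    by (intro nn_integral_mono pt)
  also have "\<dots> = ennreal (h0 powr p) + (\<Sum>j. ennreal (?c j) * emeasure nu {2 ^ j * h0<..})"
    by (subst nn_integral_add) (auto simp: nn_integral_suminf nn_integral_cmult_indicator sets emeasure_space_1)
  also have "\<dots> \<le> ennreal (h0 powr p) + (\<Sum>j. ennreal (2 powr p * h0 powr p * (K / h0 ^ d) * q ^ j))"
    using bound by (intro add_left_mono suminf_le) (auto simp: emeasure_eq_measure ennreal_mult[symmetric] intro: ennreal_leI)
  also have "\<dots> < \<infinity>"
    using q K h0 by (subst suminf_ennreal2)
      (auto intro!: summable_mult summable_geometric mult_nonneg_nonneg powr_ge_zero simp del: powr_eq_0_iff)
  finally show ?thesis .
qed

text \<open>The annulus is a difference of two tails. Scaled by \<open>h ^ d\<close> they tend to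
  \<open>\<beta>\<close> and to \<open>\<beta> / 2 ^ d\<close>, and the latter is at most
  \<open>\<beta> / 4\<close>. With relative errors of one quarter, at least
  \<open>3/4 - 5/16 = 7/16\<close> of \<open>\<beta>\<close> remains.\<close>

lemma tail_annulus_bound:
  fixes nu :: "real measure" and d :: nat
  assumes "prob_space nu" and sets: "sets nu = sets borel" and d: "2 \<le> d" and "\<beta> > 0"
    and lim: "((\<lambda>h::real. h ^ d * measure nu {h<..}) \<longlongrightarrow> \<beta>) at_top"
  obtains h0 where "1 \<le> h0" "\<And>h. h0 \<le> h \<Longrightarrow> h ^ d * measure nu {h<..} \<le> 2 * \<beta>"
    "\<And>h. h0 \<le> h \<Longrightarrow> \<beta> / 4 \<le> h ^ d * measure nu {h<..2 * h}"
proof -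
  interpret prob_space nu by fact
  have "\<forall>\<^sub>F h in at_top. dist (h ^ d * measure nu {h<..}) \<beta> < \<beta> / 4"
    using lim \<open>\<beta> > 0\<close> by (auto dest: tendstoD[of _ _ _ "\<beta> / 4"])
  then obtain h1 where h1: "\<And>h. h1 \<le> h \<Longrightarrow> \<bar>h ^ d * measure nu {h<..} - \<beta>\<bar> < \<beta> / 4"
    by (auto simp: eventually_at_top_linorder dist_real_def)
  show ?thesis
  proof
    show "1 \<le> max 1 h1" by simp
    fix h :: real assume h: "max 1 h1 \<le> h"
    show "h ^ d * measure nu {h<..} \<le> 2 * \<beta>" using h1[of h] h \<open>\<beta> > 0\<close> by (auto simp: abs_if split: if_splits)
    have "2 ^ d * (h ^ d * measure nu {2 * h<..}) < 5 / 4 * \<beta>"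
      using h1[of "2 * h"] h by (auto simp: power_mult_distrib abs_if mult.assoc split: if_splits)
    moreover have "4 * (h ^ d * measure nu {2 * h<..}) \<le> 2 ^ d * (h ^ d * measure nu {2 * h<..})"
      using d h power_increasing[of 2 d "2::real"] by (intro mult_right_mono mult_nonneg_nonneg) auto
    moreover have "3 / 4 * \<beta> < h ^ d * measure nu {h<..}"
      using h1[of h] h by (auto simp: abs_if split: if_splits)
    moreover
    have "measure nu {h<..2 * h} = measure nu {h<..} - measure nu {2 * h<..}"
    proof -
      have "{h<..2 * h} = {h<..} - {2 * h<..}" by auto
      then show ?thesis using h by (simp add: finite_measure_Diff sets greaterThan_subset_iff)
    qed
    then have "h ^ d * measure nu {h<..2 * h} = h ^ d * measure nu {h<..} - h ^ d * measure nu {2 * h<..}"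
      by (simp add: right_diff_distrib)
    ultimately show "\<beta> / 4 \<le> h ^ d * measure nu {h<..2 * h}" using \<open>\<beta> > 0\<close> by linarith
  qed
qed

subsection \<open>Poisson functionals\<close>

text \<open>Fubini isolates coordinate \<open>i\<close>. Once it is fixed at \<open>x\<close>, the
  other coordinates are independent and each contributes the same factor.\<close>

lemma nn_integral_PiM_point_vs_rest:
  fixes h :: "'a \<Rightarrow> ennreal" and q :: "'a \<times> 'a \<Rightarrow> ennreal"
  assumes M: "sigma_finite_measure M"
    and h[measurable]: "h \<in> borel_measurable M"
    and q[measurable]: "q \<in> borel_measurable (M \<Otimes>\<^sub>M M)"
    and K: "finite K" "i \<notin> K"
  shows "(\<integral>\<^sup>+ f. h (f i) * (\<Prod>j\<in>K. q (f i, f j)) \<partial>(\<Pi>\<^sub>M j\<in>insert i K. M)) =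
    (\<integral>\<^sup>+ x. h x * (\<integral>\<^sup>+ y. q (x, y) \<partial>M) ^ card K \<partial>M)"
proof -
  interpret sigma_finite_measure M by fact
  interpret P: product_sigma_finite "\<lambda>_. M" by unfold_locales
  have [measurable]: "(\<lambda>f. q (f i, f j)) \<in> borel_measurable (\<Pi>\<^sub>M j\<in>insert i K. M)" if "j \<in> K" for j
    using that by (intro measurable_compose[OF _ q] measurable_Pair measurable_component_singleton) auto
  have [measurable]: "(\<lambda>f. q (x, f j)) \<in> borel_measurable (\<Pi>\<^sub>M j\<in>K. M)"
    if "j \<in> K" "x \<in> space M" for j x
    using that by measurable
  have meas: "(\<lambda>f. h (f i) * (\<Prod>j\<in>K. q (f i, f j))) \<in> borel_measurable (\<Pi>\<^sub>M j\<in>insert i K. M)"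
    by (intro borel_measurable_times_ennreal borel_measurable_prod_ennreal measurable_compose[OF _ h]
        measurable_component_singleton) auto
  have "(\<integral>\<^sup>+ f. h (f i) * (\<Prod>j\<in>K. q (f i, f j)) \<partial>(\<Pi>\<^sub>M j\<in>insert i K. M)) =
    (\<integral>\<^sup>+ x. \<integral>\<^sup>+ f. h x * (\<Prod>j\<in>K. q (x, (f(i := x)) j)) \<partial>(\<Pi>\<^sub>M j\<in>K. M) \<partial>M)"
    by (subst P.product_nn_integral_insert_rev[OF K meas]) simp
  also have "\<dots> = (\<integral>\<^sup>+ x. h x * (\<integral>\<^sup>+ y. q (x, y) \<partial>M) ^ card K \<partial>M)"
  proof (intro nn_integral_cong)
    fix x assume x: "x \<in> space M"
    have [measurable]: "(\<lambda>y. q (x, y)) \<in> borel_measurable M" using x by measurable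
    have eq: "(\<Prod>j\<in>K. q (x, (f(i := x)) j)) = (\<Prod>j\<in>K. q (x, f j))" for f
      using K by (intro prod.cong) auto
    have "(\<integral>\<^sup>+ f. h x * (\<Prod>j\<in>K. q (x, (f(i := x)) j)) \<partial>(\<Pi>\<^sub>M j\<in>K. M)) =
       h x * (\<integral>\<^sup>+ f. (\<Prod>j\<in>K. q (x, f j)) \<partial>(\<Pi>\<^sub>M j\<in>K. M))"
      unfolding eq using x by (intro nn_integral_cmult borel_measurable_prod_ennreal) measurable
    also have "(\<integral>\<^sup>+ f. (\<Prod>j\<in>K. q (x, f j)) \<partial>(\<Pi>\<^sub>M j\<in>K. M)) = (\<Prod>j\<in>K. \<integral>\<^sup>+ y. q (x, y) \<partial>M)"
      using K x by (intro P.product_nn_integral_prod) measurable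
    finally show "(\<integral>\<^sup>+ f. h x * (\<Prod>j\<in>K. q (x, (f(i := x)) j)) \<partial>(\<Pi>\<^sub>M j\<in>K. M)) =
       h x * (\<integral>\<^sup>+ y. q (x, y) \<partial>M) ^ card K"
      by simp
  qed
  finally show ?thesis .
qed

lemma suminf_ennreal_exp:
  fixes y :: real
  assumes "0 \<le> y"
  shows "(\<Sum>k. ennreal (y ^ k / fact k)) = ennreal (exp y)"
proof -
  have "(\<lambda>k. y ^ k / fact k) sums exp y"
    using exp_converges[of y] by (simp add: divide_inverse mult.commute)
  then have "(\<lambda>k. ennreal (y ^ k / fact k)) sums ennreal (exp y)"
    using assms by (subst sums_ennreal) auto
  then show ?thesis by (simp add: sums_iff)
qed

text \<open>The Mecke formula combined with the void probability \<open>exp (- M (B\<^sub>x))\<close>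
  of the Poisson process: \<open>h x\<close> is the contribution of a point at \<open>x\<close> and \<open>B\<^sub>x\<close> is a set of positions
  at which a further point destroys that contribution.\<close>

lemma Poisson_sum_void_bound:
  fixes h :: "'a \<Rightarrow> ennreal" and B :: "('a \<times> 'a) set" and F :: "'a list \<Rightarrow> real" and V :: real
  assumes V: "emeasure M (space M) \<le> ennreal V" and "0 \<le> V"
    and h[measurable]: "h \<in> borel_measurable M"
    and B[measurable]: "B \<in> sets (M \<Otimes>\<^sub>M M)"
    and F: "\<And>k f. f \<in> space (\<Pi>\<^sub>M j\<in>{..<k}. M) \<Longrightarrow> ennreal (F (map f [0..<k])) \<le>
      (\<Sum>i<k. h (f i) * (\<Prod>j\<in>{..<k} - {i}. indicator (- B) (f i, f j)))"
  shows "(\<Sum>k. ennreal (exp (- V) / fact k) *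
      (\<integral>\<^sup>+ f. ennreal (F (map f [0..<k])) \<partial>(\<Pi>\<^sub>M j\<in>{..<k}. M))) \<le>
    (\<integral>\<^sup>+ x. h x * ennreal (exp (- measure M (Pair x -` B))) \<partial>M)"
proof -
  have "finite_measure M"
    using V by (intro finite_measureI) (auto simp: top_unique)
  then interpret finite_measure M .
  define b where "b x = measure M (Pair x -` B)" for x
  have [measurable]: "b \<in> borel_measurable M"
    unfolding b_def measure_def using measurable_emeasure_Pair[OF B] by measurable
  \<comment> \<open>\<open>- B\<close> is the complement in the whole type, so measurability is
    taken from the complement within the product space, where the two indicators agree.\<close>
  have q[measurable]: "indicator (- B) \<in> borel_measurable (M \<Otimes>\<^sub>M M)"
    using borel_measurable_indicator[OF sets.compl_sets[OF B]]
    by (rule measurable_cong[THEN iffD1, rotated]) (auto simp: indicator_def)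
  have Mr: "measure M (space M) \<le> V"
    using V \<open>0 \<le> V\<close> by (simp add: emeasure_eq_measure)
  have bV: "b x \<le> V" for x
    using Mr bounded_measure[of "Pair x -` B"] by (simp add: b_def)
  \<comment> \<open>As \<open>V\<close> bounds the total mass from above, \<open>V - b x\<close>
    bounds the mass outside the section of \<open>B\<close> at \<open>x\<close>.\<close>
  have void: "(\<integral>\<^sup>+ y. indicator (- B) (x, y) \<partial>M) \<le> ennreal (V - b x)" if x: "x \<in> space M" for x
  proof -
    have Bx: "Pair x -` B \<in> sets M" using B by (rule sets_Pair1)
    have "(\<integral>\<^sup>+ y. indicator (- B) (x, y) \<partial>M) = (\<integral>\<^sup>+ y. indicator (space M - Pair x -` B) y \<partial>M)"
      by (intro nn_integral_cong) (auto simp: indicator_def)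
    also have "\<dots> = ennreal (measure M (space M) - b x)"
      using Bx by (simp add: emeasure_eq_measure b_def measure_Diff sets.compl_sets finite_measure_compl)
    finally show ?thesis using Mr by (simp add: ennreal_leI)
  qed
  \<comment> \<open>All \<open>k\<close> summands obey the same bound. The resulting factor
    \<open>k\<close> later turns \<open>1 / fact k\<close> into
    \<open>1 / fact (k - 1)\<close>.\<close>
  have term_le: "(\<integral>\<^sup>+ f. ennreal (F (map f [0..<k])) \<partial>(\<Pi>\<^sub>M j\<in>{..<k}. M)) \<le>
    ennreal (real k) * (\<integral>\<^sup>+ x. h x * ennreal ((V - b x) ^ (k - 1)) \<partial>M)" for k
  proof -
    have ins: "insert i ({..<k} - {i}) = {..<k}" if "i < k" for i using that by auto
    have meas: "(\<lambda>f. h (f i) * (\<Prod>j\<in>{..<k} - {i}. indicator (- B) (f i, f j)))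
        \<in> borel_measurable (\<Pi>\<^sub>M j\<in>{..<k}. M)" if "i < k" for i
      using that by (intro borel_measurable_times_ennreal borel_measurable_prod_ennreal measurable_compose[OF _ h]
        measurable_compose[OF _ q] measurable_Pair measurable_component_singleton) auto
    have "(\<integral>\<^sup>+ f. ennreal (F (map f [0..<k])) \<partial>(\<Pi>\<^sub>M j\<in>{..<k}. M)) \<le>
      (\<integral>\<^sup>+ f. (\<Sum>i<k. h (f i) * (\<Prod>j\<in>{..<k} - {i}. indicator (- B) (f i, f j))) \<partial>(\<Pi>\<^sub>M j\<in>{..<k}. M))"
      by (intro nn_integral_mono F)
    also have "\<dots> = (\<Sum>i<k. \<integral>\<^sup>+ f. h (f i) * (\<Prod>j\<in>{..<k} - {i}. indicator (- B) (f i, f j)) \<partial>(\<Pi>\<^sub>M j\<in>{..<k}. M))"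
      using meas by (intro nn_integral_sum) auto
    also have "\<dots> = (\<Sum>i<k. \<integral>\<^sup>+ x. h x * (\<integral>\<^sup>+ y. indicator (- B) (x, y) \<partial>M) ^ (k - 1) \<partial>M)"
    proof (intro sum.cong refl)
      fix i assume "i \<in> {..<k}"
      then show "(\<integral>\<^sup>+ f. h (f i) * (\<Prod>j\<in>{..<k} - {i}. indicator (- B) (f i, f j)) \<partial>(\<Pi>\<^sub>M j\<in>{..<k}. M)) =
         (\<integral>\<^sup>+ x. h x * (\<integral>\<^sup>+ y. indicator (- B) (x, y) \<partial>M) ^ (k - 1) \<partial>M)"
        using nn_integral_PiM_point_vs_rest[OF sigma_finite_measure_axioms h q, of "{..<k} - {i}" i] ins[of i]
        by simp
    qed
    also have "\<dots> \<le> (\<Sum>i<k. \<integral>\<^sup>+ x. h x * ennreal ((V - b x) ^ (k - 1)) \<partial>M)"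
    proof (intro sum_mono nn_integral_mono mult_left_mono)
      fix x assume "x \<in> space M"
      then have "(\<integral>\<^sup>+ y. indicator (- B) (x, y) \<partial>M) ^ (k - 1) \<le> ennreal (V - b x) ^ (k - 1)"
        by (intro power_mono void) auto
      then show "(\<integral>\<^sup>+ y. indicator (- B) (x, y) \<partial>M) ^ (k - 1) \<le> ennreal ((V - b x) ^ (k - 1))"
        using bV[of x] by (simp add: ennreal_power)
    qed auto
    also have "\<dots> = ennreal (real k) * (\<integral>\<^sup>+ x. h x * ennreal ((V - b x) ^ (k - 1)) \<partial>M)"
      by (simp add: ennreal_of_nat_eq_real_of_nat)
    finally show ?thesis .
  qed
  let ?t = "\<lambda>k. ennreal (exp (- V) / fact k) *
      (ennreal (real k) * (\<integral>\<^sup>+ x. h x * ennreal ((V - b x) ^ (k - 1)) \<partial>M))"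
  have "(\<Sum>k. ennreal (exp (- V) / fact k) *
      (\<integral>\<^sup>+ f. ennreal (F (map f [0..<k])) \<partial>(\<Pi>\<^sub>M j\<in>{..<k}. M))) \<le> suminf ?t"
    by (intro suminf_le mult_left_mono term_le summableI) auto
  \<comment> \<open>The term at \<open>k = 0\<close> vanishes through the factor \<open>k\<close>,
    and the shift removes the truncated exponent \<open>k - 1\<close>.\<close>
  also have "suminf ?t = (\<Sum>k. ?t (k + 1))"
    by (subst suminf_offset[of ?t 1]) auto
  also have "\<dots> = (\<Sum>k. \<integral>\<^sup>+ x. h x * ennreal (exp (- V)) * ennreal ((V - b x) ^ k / fact k) \<partial>M)"
  proof (intro suminf_cong)
    fix k
    have c: "ennreal (exp (- V) / fact (k + 1)) * (ennreal (real (k + 1)) * z) = ennreal (exp (- V) / fact k) * z" for z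
      unfolding mult.assoc[symmetric]
      by (subst ennreal_mult[symmetric]) (auto simp: field_simps simp del: of_nat_Suc)
    have e: "ennreal (exp (- V) / fact k) * (h x * ennreal ((V - b x) ^ k)) =
       h x * ennreal (exp (- V)) * ennreal ((V - b x) ^ k / fact k)" for x
    proof -
      have "ennreal (exp (- V) / fact k) * ennreal ((V - b x) ^ k) = ennreal (exp (- V)) * ennreal ((V - b x) ^ k / fact k)"
        using bV[of x] by (simp add: ennreal_mult[symmetric])
      then show ?thesis by (subst mult.left_commute) (simp add: mult.assoc)
    qed
    show "?t (k + 1) = (\<integral>\<^sup>+ x. h x * ennreal (exp (- V)) * ennreal ((V - b x) ^ k / fact k) \<partial>M)"
      unfolding c by (subst nn_integral_cmult[symmetric]) (auto simp: e)
  qed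
  also have "\<dots> = (\<integral>\<^sup>+ x. (\<Sum>k. h x * ennreal (exp (- V)) * ennreal ((V - b x) ^ k / fact k)) \<partial>M)"
    by (intro nn_integral_suminf[symmetric]) measurable
  also have "\<dots> = (\<integral>\<^sup>+ x. h x * ennreal (exp (- b x)) \<partial>M)"
  proof (intro nn_integral_cong)
    fix x
    have "(\<Sum>k. h x * ennreal (exp (- V)) * ennreal ((V - b x) ^ k / fact k)) =
       h x * ennreal (exp (- V)) * ennreal (exp (V - b x))"
      using bV[of x] by (simp add: suminf_ennreal_exp del: suminf_ennreal)
    also have "\<dots> = h x * ennreal (exp (- V) * exp (V - b x))"
      by (simp add: ennreal_mult mult.assoc)
    also have "exp (- V) * exp (V - b x) = exp (- b x)" by (simp add: exp_add[symmetric])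
    finally show "(\<Sum>k. h x * ennreal (exp (- V)) * ennreal ((V - b x) ^ k / fact k)) = h x * ennreal (exp (- b x))" .
  qed
  finally show ?thesis unfolding b_def .
qed

subsection \<open>Geometry of the torus\<close>

text \<open>\<open>round\<close> selects a nearest integer, so comparison with the integer 0 gives
  the bound.\<close>

lemma tor1_le_abs: "0 < L \<Longrightarrow> tor1 L t \<le> \<bar>t\<bar>"
proof -
  assume L: "0 < L"
  have "tor1 L t = L * \<bar>t / L - of_int (round (t / L))\<bar>"
    using L by (simp add: tor1_def abs_mult_pos' right_diff_distrib)
  also have "\<dots> \<le> L * \<bar>t / L - of_int 0\<bar>"
    using L by (intro mult_left_mono round_diff_minimal) auto
  also have "\<dots> = \<bar>t\<bar>" using L by simp
  finally show ?thesis .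
qed

text \<open>A nonzero multiple of \<open>L\<close> has distance at least \<open>L / 2\<close> from
  \<open>t\<close>, so it is no closer than 0; a tie at \<open>L / 2\<close> gives the same
  value.\<close>

lemma tor1_eq_abs:
  assumes "0 < L" "\<bar>t\<bar> \<le> L / 2"
  shows "tor1 L t = \<bar>t\<bar>"
proof -
  have "\<bar>t\<bar> \<le> tor1 L t"
  proof (cases "round (t / L) = 0")
    case False
    then have "1 \<le> \<bar>real_of_int (round (t / L))\<bar>" by linarith
    then have "L \<le> \<bar>L * of_int (round (t / L))\<bar>" using assms by (simp add: abs_mult)
    then show ?thesis using assms unfolding tor1_def by linarith
  qed (simp add: tor1_def)
  with tor1_le_abs[OF assms(1)] show ?thesis by (intro antisym)
qed

lemma tor1_nonneg: "0 \<le> tor1 L t"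
  by (simp add: tor1_def)

lemma tdist_le_norm: "0 < n \<Longrightarrow> tdist n x y \<le> norm (x - y)"
  unfolding tdist_def norm_vec_def L2_set_def
  by (intro real_sqrt_le_mono sum_mono power_mono) (auto simp: tor1_le_abs tor1_nonneg)

lemma tbox_component:
  assumes "x \<in> tbox n"
  shows "\<bar>x $ i\<bar> \<le> real n / 2"
proof -
  have "- real n / 2 \<le> x $ i \<and> x $ i < real n / 2"
    using assms by (simp add: tbox_def)
  then show ?thesis by linarith
qed

text \<open>Seen from the origin, no coordinate of a box point wraps around.\<close>

lemma tdist_origin:
  assumes "0 < n" "x \<in> tbox n"
  shows "tdist n 0 x = norm x" "tdist n x 0 = norm x"
proof -
  have "\<bar>x $ i\<bar> \<le> real n / 2" for i
    using assms by (intro tbox_component)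
  then show "tdist n 0 x = norm x" "tdist n x 0 = norm x"
    using assms unfolding tdist_def norm_vec_def L2_set_def by (auto simp: tor1_eq_abs)
qed

lemma tbox_borel[measurable]: "tbox n \<in> sets borel"
proof -
  have "tbox n = (\<Inter>i. {x. - real n / 2 \<le> x $ i \<and> x $ i < real n / 2})"
    by (auto simp: tbox_def)
  also have "\<dots> \<in> sets borel" by measurable
  finally show ?thesis .
qed

lemma emeasure_lborel_cbox_cart:
  fixes a b :: "real^'d"
  assumes "\<And>i. a $ i \<le> b $ i"
  shows "emeasure lborel (cbox a b) = ennreal (\<Prod>i\<in>UNIV. b $ i - a $ i)"
proof -
  have "cbox a b \<noteq> {}" using assms by (simp add: interval_ne_empty_cart)
  then have "measure lborel (cbox a b) = (\<Prod>i\<in>UNIV. b $ i - a $ i)" by (rule content_cbox_cart)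
  then show ?thesis
    using emeasure_lborel_cbox_finite[of a b] by (subst emeasure_eq_ennreal_measure) auto
qed

lemma emeasure_tbox_le: "emeasure lborel (tbox n :: (real^'d) set) \<le> ennreal (real n ^ CARD('d))"
proof -
  have "- real n / 2 \<le> x $ i \<and> x $ i \<le> real n / 2" if "x \<in> tbox n" for x :: "real^'d" and i
    using tbox_component[OF that, of i] by linarith
  then have "emeasure lborel (tbox n :: (real^'d) set) \<le>
      emeasure lborel (cbox (\<chi> i. - real n / 2) (\<chi> i. real n / 2) :: (real^'d) set)"
    by (intro emeasure_mono) (auto simp: mem_box_cart)
  also have "\<dots> = ennreal (real n ^ CARD('d))"
    by (subst emeasure_lborel_cbox_cart) auto
  finally show ?thesis .
qed

lemma norm_tbox_le:
  fixes x :: "real^'d"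
  assumes "x \<in> tbox n"
  shows "norm x \<le> real CARD('d) * real n"
proof -
  have "norm x \<le> (\<Sum>i\<in>UNIV. \<bar>x $ i\<bar>)" by (rule norm_le_l1_cart)
  also have "\<dots> \<le> (\<Sum>i\<in>(UNIV::'d set). real n)"
  proof (intro sum_mono)
    fix i show "\<bar>x $ i\<bar> \<le> real n"
      using tbox_component[OF assms, of i] by linarith
  qed
  finally show ?thesis by simp
qed

text \<open>The set lies in a cube of half side \<open>min R n\<close>: the ball bounds each
  coordinate by \<open>R\<close>, the box by \<open>n / 2\<close>, which is relaxed to
  \<open>n\<close>.\<close>

lemma emeasure_tbox_ball_le:
  assumes "0 \<le> R"
  shows "emeasure lborel {x \<in> tbox n :: (real^'d) set. norm x \<le> R} \<le>
    ennreal ((2 * min R (real n)) ^ CARD('d))"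
proof -
  let ?r = "min R (real n)"
  have *: "- ?r \<le> x $ i \<and> x $ i \<le> ?r" if "x \<in> tbox n" "norm x \<le> R" for x :: "real^'d" and i
  proof -
    have "\<bar>x $ i\<bar> \<le> R" using that(2) component_le_norm_cart[of x i] by linarith
    moreover have "\<bar>x $ i\<bar> \<le> real n"
      using tbox_component[OF that(1), of i] by linarith
    ultimately show ?thesis by auto
  qed
  have "emeasure lborel {x \<in> tbox n :: (real^'d) set. norm x \<le> R} \<le>
      emeasure lborel (cbox (\<chi> i. - ?r) (\<chi> i. ?r) :: (real^'d) set)"
    using * by (intro emeasure_mono) (auto simp: mem_box_cart)
  also have "\<dots> = ennreal ((2 * ?r) ^ CARD('d))"
    using assms by (subst emeasure_lborel_cbox_cart) auto
  finally show ?thesis .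
qed

text \<open>This keeps the centre of the ball inscribed below inside the box. The split on the sign
  is due to the strict upper bound of the half-open box.\<close>

lemma tbox_shrink:
  assumes "x \<in> tbox n" "0 \<le> l" "l \<le> 1" "0 < n"
  shows "l *\<^sub>R x \<in> tbox n"
  unfolding tbox_def
proof (intro CollectI allI)
  fix i
  have x: "- real n / 2 \<le> x $ i" "x $ i < real n / 2" using assms by (auto simp: tbox_def)
  have "l * (- real n / 2) \<le> l * x $ i" using x assms by (intro mult_left_mono) auto
  moreover have "l * (real n / 2) \<le> 1 * (real n / 2)" using assms by (intro mult_right_mono) auto
  moreover have "l * x $ i < real n / 2"
  proof (cases "x $ i \<le> 0")
    case True
    then have "l * x $ i \<le> 0" using assms by (simp add: mult_nonneg_nonpos)
    moreover have "0 < real n / 2" using \<open>0 < n\<close> by simp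
    ultimately show ?thesis by linarith
  next
    case False
    then have "l * x $ i \<le> 1 * x $ i" using assms by (intro mult_right_mono) auto
    then show ?thesis using x by simp
  qed
  ultimately show "- real n / 2 \<le> (l *\<^sub>R x) $ i \<and> (l *\<^sub>R x) $ i < real n / 2" by simp
qed

text \<open>The intersection contains a ball of radius \<open>h / 2\<close> centred on the segment from \<open>x\<close> to the
  origin, and in that ball a cube that points towards the inside of the box in every coordinate.\<close>

lemma emeasure_tbox_lens_ge:
  fixes x :: "real^'d"
  assumes x: "x \<in> tbox n" "norm x \<le> R" and h: "0 < h" "h \<le> R" "h \<le> real n"
  shows "ennreal ((h / (2 * real CARD('d))) ^ CARD('d)) \<le>
    emeasure lborel {y \<in> tbox n. norm y \<le> R \<and> norm (y - x) \<le> h}"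
proof -
  have n: "0 < n" using h by (cases n) auto
  have "\<exists>c \<in> tbox n. norm c + h / 2 \<le> R \<and> norm (c - x) \<le> h / 2"
  proof (cases "norm x \<le> h / 2")
    case True
    then show ?thesis using n h by (intro bexI[of _ 0]) (auto simp: tbox_def)
  next
    case False
    \<comment> \<open>The centre moves from \<open>x\<close> towards the origin by exactly
      \<open>h / 2\<close>. This frees a margin of \<open>h / 2\<close> below \<open>R\<close> and
      stays within \<open>h / 2\<close> of \<open>x\<close>.\<close>
    define l where "l = 1 - h / (2 * norm x)"
    have nx: "0 < norm x" "h < 2 * norm x" using False h by auto
    then have l: "0 \<le> l" "l \<le> 1" using h by (auto simp: l_def field_simps)
    have "norm (l *\<^sub>R x) = norm x - h / 2"
      using nx l by (simp add: l_def field_simps)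
    moreover have "norm (l *\<^sub>R x - x) = h / 2"
    proof -
      have "l *\<^sub>R x - x = (- (h / (2 * norm x))) *\<^sub>R x" by (simp add: l_def algebra_simps)
      then show ?thesis using nx h by simp
    qed
    ultimately show ?thesis using x l n by (intro bexI[of _ "l *\<^sub>R x"] tbox_shrink) auto
  qed
  then obtain c where c: "c \<in> tbox n" "norm c + h / 2 \<le> R" "norm (c - x) \<le> h / 2" by blast
  \<comment> \<open>In a cube of side \<open>r\<close> with corner \<open>c\<close>, the sum norm of
    the difference from \<open>c\<close> is at most \<open>CARD('d) * r = h / 2\<close>.\<close>
  define r where "r = h / (2 * real CARD('d))"
  have r0: "0 < r" using h by (simp add: r_def)
  have "1 \<le> real CARD('d)" by (simp add: Suc_leI)
  then have "r \<le> h / 2" using h unfolding r_def by (intro divide_left_mono) auto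
  then have rn: "r \<le> real n / 2" using h by simp
  \<comment> \<open>Each side starts at \<open>c $ i\<close> and runs in the direction of zero.
    Because of \<open>r \<le> n / 2\<close> it cannot pass the opposite face.\<close>
  define lo hi :: "real^'d" where "lo = (\<chi> i. if c $ i < 0 then c $ i else c $ i - r)"
    and "hi = (\<chi> i. if c $ i < 0 then c $ i + r else c $ i)"
  have "cbox lo hi \<subseteq> {y \<in> tbox n. norm y \<le> R \<and> norm (y - x) \<le> h}"
  proof
    fix y assume y: "y \<in> cbox lo hi"
    have yi: "\<bar>y $ i - c $ i\<bar> \<le> r" "- real n / 2 \<le> y $ i" "y $ i < real n / 2" for i
    proof -
      have "lo $ i \<le> y $ i" "y $ i \<le> hi $ i" using y by (auto simp: mem_box_cart)
      moreover have "- real n / 2 \<le> c $ i" "c $ i < real n / 2" using c by (auto simp: tbox_def)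
      ultimately show "\<bar>y $ i - c $ i\<bar> \<le> r" "- real n / 2 \<le> y $ i" "y $ i < real n / 2"
        using r0 rn by (auto simp: lo_def hi_def split: if_splits)
    qed
    have "norm (y - c) \<le> (\<Sum>i\<in>UNIV. \<bar>(y - c) $ i\<bar>)" by (rule norm_le_l1_cart)
    also have "\<dots> \<le> (\<Sum>i\<in>(UNIV::'d set). r)" using yi by (intro sum_mono) auto
    finally have yc: "norm (y - c) \<le> h / 2" by (simp add: r_def)
    have "norm y \<le> norm c + norm (y - c)" by (metis add.commute diff_add_cancel norm_triangle_ineq)
    moreover have "norm (y - x) \<le> norm (y - c) + norm (c - x)"
      by (metis diff_add_cancel add_diff_eq norm_triangle_ineq)
    ultimately show "y \<in> {y \<in> tbox n. norm y \<le> R \<and> norm (y - x) \<le> h}"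
      using yc c yi by (auto simp: tbox_def)
  qed
  then have "emeasure lborel (cbox lo hi) \<le>
      emeasure lborel {y \<in> tbox n. norm y \<le> R \<and> norm (y - x) \<le> h}"
    by (intro emeasure_mono) auto
  moreover have "emeasure lborel (cbox lo hi) = ennreal (r ^ CARD('d))"
  proof -
    have "lo $ i \<le> hi $ i" "hi $ i - lo $ i = r" for i using r0 by (auto simp: lo_def hi_def)
    then show ?thesis by (subst emeasure_lborel_cbox_cart) auto
  qed
  ultimately show ?thesis by (simp add: r_def)
qed

subsection \<open>Expected outdegree\<close>

text \<open>The pairs \<open>((x, t), (y, w))\<close> such that a point \<open>(y, w)\<close> certainly removes the edge from
  \<open>(o, R)\<close> to \<open>(x, t)\<close>. The toroidal distance is replaced by the Euclidean one, which is at least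
  as large, so that only part of the blocking region is used.\<close>

definition blockers :: "nat \<Rightarrow> real \<Rightarrow> (((real^'d) \<times> real) \<times> ((real^'d) \<times> real)) set" where
  "blockers n R = {p. fst (fst p) \<in> tbox n \<and> fst (snd p) \<in> tbox n \<and> norm (fst (snd p)) \<le> R \<and>
     snd (fst p) < snd (snd p) \<and> snd (snd p) < R \<and> norm (fst (snd p) - fst (fst p)) \<le> snd (snd p)}"

section \<open>The marked intensity measure: measurability and mass\<close>

lemma space_markM:
  assumes sets_nu: "sets nu = sets borel"
  shows "space (markM n nu) = tbox n \<times> UNIV"
  using sets_eq_imp_space_eq[OF sets_nu]
  by (simp add: markM_def space_pair_measure space_restrict_space)

lemma measurable_fst_markM[measurable]: "fst \<in> borel_measurable (markM n nu)"
  unfolding markM_def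
  by (rule measurable_compose[OF measurable_fst]) (auto intro: measurable_restrict_space1)

lemma measurable_snd_markM:
  assumes [measurable_cong]: "sets nu = sets borel"
  shows "snd \<in> borel_measurable (markM n nu)"
  unfolding markM_def by measurable

lemma emeasure_markM_Times:
  assumes prob: "prob_space nu" and sets_nu: "sets nu = sets borel"
    and "A \<in> sets borel" "A \<subseteq> tbox n" "I \<in> sets borel"
  shows "A \<times> I \<in> sets (markM n nu)"
    "emeasure (markM n nu) (A \<times> I) = emeasure lborel A * emeasure nu I"
proof -
  interpret prob_space nu by (rule prob)
  have A: "A \<in> sets (restrict_space lborel (tbox n))"
    using assms by (simp add: sets_restrict_space_iff)
  then show "A \<times> I \<in> sets (markM n nu)" "emeasure (markM n nu) (A \<times> I) = emeasure lborel A * emeasure nu I"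
    using assms unfolding markM_def
    by (auto simp: emeasure_pair_measure_Times sets_nu emeasure_restrict_space)
qed

lemma emeasure_markM_space_le:
  assumes prob: "prob_space nu" and sets_nu: "sets nu = sets borel"
  shows "emeasure (markM n nu) (space (markM n nu :: ((real^'d) \<times> real) measure)) \<le> ennreal (real n ^ CARD('d))"
proof -
  interpret prob_space nu by (rule prob)
  have "emeasure nu UNIV = 1"
    using emeasure_space_1 sets_eq_imp_space_eq[OF sets_nu] by simp
  then show ?thesis
    using emeasure_tbox_le[of n, where 'd='d]
    by (simp add: space_markM[OF sets_nu] emeasure_markM_Times[OF prob sets_nu])
qed

lemma finite_measure_markM:
  assumes "prob_space nu" "sets nu = sets borel"
  shows "finite_measure (markM n nu :: ((real^'d) \<times> real) measure)"
  using emeasure_markM_space_le[OF assms, of n, where 'd='d]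
  by (intro finite_measureI) (auto simp: top_unique)

text \<open>The two box conditions place the set inside the product space, where the remaining
  inequalities are measurable.\<close>

lemma blockers_sets:
  assumes sets_nu: "sets nu = sets borel"
  shows "blockers n R \<in> sets (markM n nu \<Otimes>\<^sub>M markM n nu)"
proof -
  note [measurable] = measurable_snd_markM[OF sets_nu]
  have "blockers n R = {p \<in> space (markM n nu \<Otimes>\<^sub>M markM n nu). norm (fst (snd p)) \<le> R \<and>
     snd (fst p) < snd (snd p) \<and> snd (snd p) < R \<and> norm (fst (snd p) - fst (fst p)) \<le> snd (snd p)}"
    by (auto simp: blockers_def space_pair_measure space_markM[OF sets_nu])
  also have "\<dots> \<in> sets (markM n nu \<Otimes>\<^sub>M markM n nu)" by measurable
  finally show ?thesis .
qed

section \<open>Mass of the blocking region\<close>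

text \<open>For marks in \<open>(h, 2 * h]\<close> the blocking positions contain a lens of volume
  at least \<open>(h / (2 * d)) ^ d\<close>, and such marks have probability at least
  \<open>\<kappa> / h ^ d\<close>. The powers of \<open>h\<close> cancel, so each of the
  \<open>J\<close> disjoint scales contributes the same constant.\<close>

lemma measure_blockers_ge:
  fixes x :: "real^'d"
  assumes prob: "prob_space nu" and sets_nu: "sets nu = sets borel"
    and annulus: "\<And>h. h0 \<le> h \<Longrightarrow> \<kappa> \<le> h ^ CARD('d) * measure nu {h<..2 * h}"
    and T: "0 < h0" "h0 \<le> T" "t \<le> T" and J: "J = 0 \<or> 2 ^ J * T < min R (real n)"
    and x: "x \<in> tbox n" "norm x \<le> R"
  shows "real J * (\<kappa> / (2 * real CARD('d)) ^ CARD('d)) \<le>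
    measure (markM n nu) (Pair (x, t) -` blockers n R)"
proof -
  interpret prob_space nu by (rule prob)
  let ?M = "markM n nu :: ((real^'d) \<times> real) measure"
  interpret M: finite_measure ?M by (rule finite_measure_markM[OF prob sets_nu])
  let ?c = "(2 * real CARD('d)) ^ CARD('d)"
  define A where "A h = {y \<in> tbox n. norm y \<le> R \<and> norm (y - x) \<le> h}" for h
  \<comment> \<open>The lens radius is the lower end of the mark range, so every mark in the range
    reaches \<open>x\<close> from every point of the lens.\<close>
  define P where "P j = A (2 ^ j * T) \<times> {2 ^ j * T<..2 * (2 ^ j * T)}" for j :: nat
  have "{y \<in> space borel. norm y \<le> R \<and> norm (y - x) \<le> h} \<in> sets borel" for h by measurable
  then have A: "A h \<in> sets borel" "A h \<subseteq> tbox n" for h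
    using sets.Int[OF tbox_borel[of n]] by (auto simp: A_def Int_def)
  have P: "P j \<in> sets ?M" for j
    unfolding P_def using A by (intro emeasure_markM_Times[OF prob sets_nu]) auto
  \<comment> \<open>The upper end of each range is at most \<open>2 ^ J * T\<close>; hence marks
    stay below \<open>R\<close> and lens radii below \<open>n\<close>.\<close>
  have step: "2 ^ j * T * 2 \<le> 2 ^ J * T" if "j < J" for j
  proof -
    have "(2::real) ^ (j + 1) \<le> 2 ^ J" using that by (intro power_increasing) auto
    then have "2 ^ (j + 1) * T \<le> 2 ^ J * T" using T by (intro mult_right_mono) auto
    then show ?thesis by (simp add: mult_ac)
  qed
  have pos: "0 < 2 ^ j * T" "h0 \<le> 2 ^ j * T" "t \<le> 2 ^ j * T" for j
  proof -
    have "T \<le> 2 ^ j * T" using T by simp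
    then show "0 < 2 ^ j * T" "h0 \<le> 2 ^ j * T" "t \<le> 2 ^ j * T" using T by linarith+
  qed
  have mP: "\<kappa> / ?c \<le> measure ?M (P j)" if j: "j < J" for j
  proof -
    let ?h = "2 ^ j * T"
    have h: "0 < ?h" "?h \<le> R" "?h \<le> real n"
      using step[OF j] J j pos[of j] by auto
    have "ennreal ((?h / (2 * real CARD('d))) ^ CARD('d)) * ennreal (measure nu {?h<..2 * ?h})
        \<le> emeasure lborel (A ?h) * emeasure nu {?h<..2 * ?h}"
      using emeasure_tbox_lens_ge[OF x h] unfolding A_def emeasure_eq_measure
      by (intro mult_right_mono) auto
    also have "\<dots> = emeasure ?M (P j)"
      unfolding P_def using A by (simp add: emeasure_markM_Times[OF prob sets_nu])
    finally have le: "(?h / (2 * real CARD('d))) ^ CARD('d) * measure nu {?h<..2 * ?h} \<le> measure ?M (P j)"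
      using h by (simp add: M.emeasure_eq_measure ennreal_mult[symmetric])
    have "\<kappa> / ?c \<le> ?h ^ CARD('d) * measure nu {?h<..2 * ?h} / ?c"
      using annulus[OF pos(2)] by (intro divide_right_mono) auto
    also have "\<dots> = (?h / (2 * real CARD('d))) ^ CARD('d) * measure nu {?h<..2 * ?h}"
      by (simp add: power_divide)
    finally show ?thesis using le by linarith
  qed
  have disj: "disjoint_family_on P {..<J}"
    unfolding disjoint_family_on_def
  proof (intro ballI impI)
    have *: "P i \<inter> P j = {}" if "i < j" for i j :: nat
    proof -
      have "(2::real) ^ (i + 1) \<le> 2 ^ j" using that by (intro power_increasing) auto
      then have "2 ^ (i + 1) * T \<le> 2 ^ j * T" using T by (intro mult_right_mono) auto
      then show ?thesis by (auto simp: P_def)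
    qed
    fix i j :: nat assume "i \<noteq> j"
    then show "P i \<inter> P j = {}" using *[of i j] *[of j i] by (cases i j rule: linorder_cases) auto
  qed
  have "real J * (\<kappa> / ?c) = (\<Sum>j<J. \<kappa> / ?c)" by simp
  also have "\<dots> \<le> (\<Sum>j<J. measure ?M (P j))" using mP by (intro sum_mono) auto
  also have "\<dots> = measure ?M (\<Union>j<J. P j)"
    using P disj by (intro M.finite_measure_finite_Union[symmetric]) auto
  also have "\<dots> \<le> measure ?M (Pair (x, t) -` blockers n R)"
  proof (intro M.finite_measure_mono)
    show "Pair (x, t) -` blockers n R \<in> sets ?M" by (rule sets_Pair1[OF blockers_sets[OF sets_nu]])
    show "(\<Union>j<J. P j) \<subseteq> Pair (x, t) -` blockers n R"
    proof safe
      fix y w j assume j: "j < J" and "(y, w) \<in> P j"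
      then have yw: "y \<in> tbox n" "norm y \<le> R" "norm (y - x) \<le> 2 ^ j * T" "2 ^ j * T < w" "w \<le> 2 ^ j * T * 2"
        by (auto simp: P_def A_def)
      moreover have "w < R" using yw(5) step[OF j] J j by auto
      moreover have "t < w" using yw(4) pos(3)[of j] by linarith
      ultimately show "(y, w) \<in> Pair (x, t) -` blockers n R" using x by (simp add: blockers_def)
    qed
  qed
  finally show ?thesis .
qed

text \<open>With \<open>J\<close> dyadic scales between \<open>T = max t h0\<close> and
  \<open>r = min R n\<close>, the exponential is at most \<open>2 powr (- J * g)\<close>, and
  \<open>2 ^ J\<close> is at least \<open>r / (2 * T)\<close>. The maximum with \<open>h0\<close>
  keeps all scales in the range of the annulus bound.\<close>

lemma exp_measure_blockers_le:
  fixes x :: "real^'d"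
  assumes prob: "prob_space nu" and sets_nu: "sets nu = sets borel"
    and annulus: "\<And>h. h0 \<le> h \<Longrightarrow> \<kappa> \<le> h ^ CARD('d) * measure nu {h<..2 * h}"
    and "0 < h0" and x: "x \<in> tbox n" "norm x \<le> R" and "0 < R" "0 < n"
    and g: "0 < g" "g \<le> \<kappa> / (2 * real CARD('d)) ^ CARD('d)"
  shows "exp (- measure (markM n nu) (Pair (x, t) -` blockers n R)) \<le>
    2 powr g * max t h0 powr g / min R (real n) powr g"
proof -
  define T r where "T = max t h0" and "r = min R (real n)"
  let ?k = "\<kappa> / (2 * real CARD('d)) ^ CARD('d)"
  have T: "0 < T" "h0 \<le> T" "t \<le> T" using \<open>0 < h0\<close> by (auto simp: T_def)
  have r: "0 < r" using \<open>0 < R\<close> \<open>0 < n\<close> by (simp add: r_def)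
  obtain J where J: "r \<le> 2 ^ (J + 1) * T" "J = 0 \<or> 2 ^ J * T < r"
    using dyadic_index[OF T(1)] by blast
  \<comment> \<open>Inserting \<open>ln 2 < 1\<close> replaces base \<open>exp 1\<close> by base 2,
    which matches the dyadic scales.\<close>
  have "real J * g * ln 2 \<le> real J * g * 1"
    using g ln_2_less_1 by (intro mult_left_mono) auto
  also have "\<dots> \<le> real J * ?k" using g by (simp only: mult_1_right) (intro mult_left_mono, auto)
  also have "\<dots> \<le> measure (markM n nu) (Pair (x, t) -` blockers n R)"
    using measure_blockers_ge[OF prob sets_nu annulus \<open>0 < h0\<close> T(2,3) J(2)[unfolded r_def] x] by simp
  finally have "exp (- measure (markM n nu) (Pair (x, t) -` blockers n R)) \<le> exp (- (real J * g * ln 2))"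
    by simp
  also have "\<dots> = exp (- (real J * ln 2)) powr g"
    unfolding exp_powr_real by (simp add: mult_ac)
  also have "\<dots> = (1 / 2 ^ J) powr g"
    by (simp add: exp_minus exp_of_nat_mult divide_inverse del: powr_eq_0_iff)
  also have "\<dots> \<le> (2 * T / r) powr g"
    using J(1) r T(1) g by (intro powr_mono2) (simp_all add: divide_simps mult_ac)
  also have "\<dots> = 2 powr g * T powr g / r powr g"
    by (simp only: powr_divide powr_mult)
  finally show ?thesis by (simp add: T_def r_def)
qed

section \<open>Bounds for the expected outdegree\<close>

text \<open>A surviving edge excludes every blocker, so the edge indicator is at most a product over
  the other points. This is the form required by \<open>Poisson_sum_void_bound\<close>.\<close>

lemma ennreal_Dout_le:
  fixes f :: "nat \<Rightarrow> (real^'d) \<times> real"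
  assumes sets_nu: "sets nu = sets borel" and n: "0 < n" and f: "f \<in> space (\<Pi>\<^sub>M j\<in>{..<k}. markM n nu)"
  shows "ennreal (Dout n a R (map f [0..<k])) \<le> (\<Sum>i<k.
    (ennreal (pw (norm (fst (f i))) a) * indicator {p. norm (fst p) \<le> R \<and> 0 \<le> snd p \<and> snd p < R} (f i)) *
    (\<Prod>j\<in>{..<k} - {i}. indicator (- blockers n R) (f i, f j)))"
proof -
  define \<phi> where "\<phi> = insert (0, R) (set (map f [0..<k]))"
  have pw: "0 \<le> pw z a" for z by (simp add: pw_def)
  have box: "fst (f i) \<in> tbox n" if "i < k" for i
    using f that by (auto simp: space_PiM PiE_iff space_markM[OF sets_nu] mem_Times_iff)
  have "ennreal (Dout n a R (map f [0..<k])) =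
     (\<Sum>i<k. ennreal (pw (tdist n (fst (f i)) 0) a * (if thin_edge n \<phi> (0, R) (f i) then 1 else 0)))"
    unfolding Dout_def \<phi>_def by (subst sum_ennreal) (simp_all add: pw)
  also have "\<dots> \<le> (\<Sum>i<k.
    (ennreal (pw (norm (fst (f i))) a) * indicator {p. norm (fst p) \<le> R \<and> 0 \<le> snd p \<and> snd p < R} (f i)) *
    (\<Prod>j\<in>{..<k} - {i}. indicator (- blockers n R) (f i, f j)))"
  proof (intro sum_mono)
    fix i assume "i \<in> {..<k}"
    then have i: "i < k" by simp
    show "ennreal (pw (tdist n (fst (f i)) 0) a * (if thin_edge n \<phi> (0, R) (f i) then 1 else 0)) \<le>
      (ennreal (pw (norm (fst (f i))) a) * indicator {p. norm (fst p) \<le> R \<and> 0 \<le> snd p \<and> snd p < R} (f i)) *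
      (\<Prod>j\<in>{..<k} - {i}. indicator (- blockers n R) (f i, f j))"
    proof (cases "thin_edge n \<phi> (0, R) (f i)")
      case True
      have "(f i, f j) \<notin> blockers n R" if "j < k" for j
      proof
        assume b: "(f i, f j) \<in> blockers n R"
        have "tdist n (fst (f j)) (fst (f i)) \<le> snd (f j)"
          using b tdist_le_norm[OF n, of "fst (f j)" "fst (f i)"] by (auto simp: blockers_def)
        moreover have "tdist n 0 (fst (f j)) \<le> R"
          using b tdist_origin[OF n box[OF that]] by (auto simp: blockers_def)
        moreover have "snd (f i) < snd (f j)" "snd (f j) < R" using b by (auto simp: blockers_def)
        moreover have "f j \<in> \<phi>" using that by (simp add: \<phi>_def)
        moreover have "\<not> (\<exists>z\<in>\<phi>. tdist n 0 (fst z) \<le> R \<and> snd (f i) < snd z \<and> snd z < R \<and>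
            tdist n (fst z) (fst (f i)) \<le> snd z)"
          using True by (simp add: thin_edge_def)
        ultimately show False by blast
      qed
      then have "(\<Prod>j\<in>{..<k} - {i}. indicator (- blockers n R) (f i, f j)) = (1::ennreal)"
        by (intro prod.neutral) (auto simp: indicator_def)
      moreover have "f i \<in> {p. norm (fst p) \<le> R \<and> 0 \<le> snd p \<and> snd p < R}"
        using True by (simp add: thin_edge_def tdist_origin[OF n box[OF i]])
      ultimately show ?thesis by (simp add: tdist_origin[OF n box[OF i]])
    qed simp
  qed
  finally show ?thesis .
qed

text \<open>The weight is at most \<open>(d * min R n) powr a\<close> and the void probability is
  bounded by a function of the mark \<open>t\<close> alone. The integral thus splits into the volume
  of the reachable set, at most \<open>(2 * min R n) ^ d\<close>, and a moment of the mark.\<close>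

lemma ppp_expect_Dout_le:
  assumes prob: "prob_space nu" and sets_nu: "sets nu = sets borel"
    and annulus: "\<And>h. h0 \<le> h \<Longrightarrow> \<kappa> \<le> h ^ CARD('d::finite) * measure nu {h<..2 * h}"
    and "0 < h0" and R: "0 < R" and n: "0 < n" and a: "0 \<le> a"
    and g: "0 < g" "g \<le> \<kappa> / (2 * real CARD('d)) ^ CARD('d)"
  shows "ppp_expect n nu (\<lambda>xs::((real^'d) \<times> real) list. Dout n a R xs) \<le>
    ennreal (real CARD('d) powr a * 2 ^ CARD('d) * 2 powr g * min R (real n) powr (real CARD('d) + a - g)) *
    (\<integral>\<^sup>+ t. ennreal (max t h0 powr g) \<partial>nu)"
proof -
  note [measurable_cong] = sets_nu
  note [measurable] = measurable_snd_markM[OF sets_nu]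
  interpret prob_space nu by (rule prob)
  let ?M = "markM n nu :: ((real^'d) \<times> real) measure"
  let ?d = "real CARD('d)" and ?R = "min R (real n)"
  have R': "0 < ?R" using R n by simp
  let ?h = "\<lambda>p::(real^'d) \<times> real. ennreal (pw (norm (fst p)) a) *
      indicator {p. norm (fst p) \<le> R \<and> 0 \<le> snd p \<and> snd p < R} p :: ennreal"
  let ?A = "{x \<in> tbox n. norm x \<le> R} :: (real^'d) set"
  let ?c = "(?d * ?R) powr a * (2 powr g / ?R powr g)"
  have "{x \<in> space borel. norm (x::real^'d) \<le> R} \<in> sets borel" by measurable
  then have A: "?A \<in> sets borel" "?A \<subseteq> tbox n"
    using sets.Int[OF tbox_borel[of n]] by (auto simp: Int_def)
  have h[measurable]: "?h \<in> borel_measurable ?M"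
    unfolding pw_def by (cases "a = 0") measurable
  have "ppp_expect n nu (\<lambda>xs::((real^'d) \<times> real) list. Dout n a R xs) \<le>
    (\<integral>\<^sup>+ p. ?h p * ennreal (exp (- measure ?M (Pair p -` blockers n R))) \<partial>?M)"
    unfolding ppp_expect_def
    by (rule Poisson_sum_void_bound[OF emeasure_markM_space_le[OF prob sets_nu] _ h
        blockers_sets[OF sets_nu] ennreal_Dout_le[OF sets_nu n]]) auto
  also have "\<dots> \<le> (\<integral>\<^sup>+ p. ennreal ?c * (indicator ?A (fst p) * ennreal (max (snd p) h0 powr g)) \<partial>?M)"
  proof (intro nn_integral_mono)
    fix p assume "p \<in> space ?M"
    then have box: "fst p \<in> tbox n" by (auto simp: space_markM[OF sets_nu])
    show "?h p * ennreal (exp (- measure ?M (Pair p -` blockers n R))) \<le>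
       ennreal ?c * (indicator ?A (fst p) * ennreal (max (snd p) h0 powr g))"
    proof (cases "norm (fst p) \<le> R")
      case True
      have "1 \<le> ?d" by (simp add: Suc_leI)
      then have "R \<le> ?d * R" using R by simp
      then have "norm (fst p) \<le> ?d * ?R"
        using norm_tbox_le[OF box] True by (auto simp: min_def)
      \<comment> \<open>For \<open>a = 0\<close> both sides equal 1, also at the origin, since the
        base on the right is positive.\<close>
      then have "pw (norm (fst p)) a \<le> (?d * ?R) powr a"
        using a R' powr_realpow[of "?d * ?R" 0]
        by (cases "a = 0") (auto simp: pw_def simp del: powr_zero_eq_one powr_eq_0_iff intro!: powr_mono2)
      then have "?h p \<le> ennreal ((?d * ?R) powr a)"
        by (auto simp: indicator_def intro!: ennreal_leI)
      moreover have "exp (- measure ?M (Pair p -` blockers n R)) \<le> 2 powr g * max (snd p) h0 powr g / ?R powr g"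
        using exp_measure_blockers_le[OF prob sets_nu annulus \<open>0 < h0\<close> box True R n g, of "snd p"] by simp
      ultimately have "?h p * ennreal (exp (- measure ?M (Pair p -` blockers n R))) \<le>
         ennreal ((?d * ?R) powr a) * ennreal (2 powr g * max (snd p) h0 powr g / ?R powr g)"
        by (intro mult_mono ennreal_leI) auto
      also have "\<dots> = ennreal ?c * ennreal (max (snd p) h0 powr g)"
        by (simp add: ennreal_mult[symmetric] mult_ac)
      finally show ?thesis using True box by simp
    qed simp
  qed
  also have "\<dots> = ennreal ?c * (\<integral>\<^sup>+ p. indicator ?A (fst p) * ennreal (max (snd p) h0 powr g) \<partial>?M)"
  proof (intro nn_integral_cmult)
    have [measurable]: "(\<lambda>p. indicator ?A (fst p) :: ennreal) \<in> borel_measurable ?M"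
      using A by (intro measurable_compose[OF measurable_fst_markM borel_measurable_indicator]) auto
    show "(\<lambda>p. indicator ?A (fst p) * ennreal (max (snd p) h0 powr g)) \<in> borel_measurable ?M" by measurable
  qed
  also have "(\<integral>\<^sup>+ p. indicator ?A (fst p) * ennreal (max (snd p) h0 powr g) \<partial>?M) =
      (\<integral>\<^sup>+ x. \<integral>\<^sup>+ t. indicator ?A x * ennreal (max t h0 powr g) \<partial>nu \<partial>restrict_space lborel (tbox n))"
  proof -
    have [measurable]: "(\<lambda>p. indicator ?A (fst p) :: ennreal) \<in> borel_measurable (restrict_space lborel (tbox n) \<Otimes>\<^sub>M nu)"
      using measurable_compose[OF measurable_fst_markM[of n nu] borel_measurable_indicator[OF A(1)]]
      by (simp add: markM_def)
    show ?thesis unfolding markM_def by (subst nn_integral_fst[symmetric]) auto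
  qed
  also have "\<dots> = emeasure lborel ?A * (\<integral>\<^sup>+ t. ennreal (max t h0 powr g) \<partial>nu)"
  proof -
    have "?A \<in> sets (restrict_space lborel (tbox n))" using A by (simp add: sets_restrict_space_iff)
    then show ?thesis using A
      by (simp add: nn_integral_cmult nn_integral_multc emeasure_restrict_space)
  qed
  also have "ennreal ?c * \<dots> \<le> ennreal ?c * (ennreal ((2 * ?R) ^ CARD('d)) * (\<integral>\<^sup>+ t. ennreal (max t h0 powr g) \<partial>nu))"
    using emeasure_tbox_ball_le[of R n, where 'd='d] R by (intro mult_left_mono mult_right_mono) auto
  also have "\<dots> = ennreal (?c * (2 * ?R) ^ CARD('d)) * (\<integral>\<^sup>+ t. ennreal (max t h0 powr g) \<partial>nu)"
    using R' by (subst ennreal_mult) (auto simp: mult.assoc)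
  also have "?c * (2 * ?R) ^ CARD('d) = ?d powr a * 2 ^ CARD('d) * 2 powr g * ?R powr (?d + a - g)"
  proof -
    have "?R powr (?d + a) = ?R powr (?d + a - g) * ?R powr g" "?R powr (?d + a) = ?R ^ CARD('d) * ?R powr a"
      using R' powr_add_real[OF R', of "?d + a - g" g] powr_add_real[OF R', of ?d a]
      by (simp_all only: diff_add_cancel powr_realpow)
    moreover have "0 < ?R powr g" using R' by (simp only: powr_gt_zero less_imp_neq[symmetric] simp_thms)
    ultimately have "?R powr (?d + a - g) = ?R ^ CARD('d) * ?R powr a / ?R powr g"
      by (simp only: eq_divide_eq less_imp_neq[symmetric] simp_thms if_True if_False)
    then show ?thesis by (simp add: powr_mult power_mult_distrib del: powr_eq_0_iff)
  qed
  finally show ?thesis .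
qed

text \<open>The power \<open>d + a - g\<close> of \<open>min R n\<close> is shared out:
  \<open>a - e\<close> goes to \<open>n\<close> and \<open>d + e - g\<close> to \<open>R\<close>. A
  larger \<open>e\<close> saves more in \<open>n\<close> at the price of a higher moment of
  \<open>R\<close>.\<close>

lemma EDout_le:
  assumes prob: "prob_space nu" and sets_nu: "sets nu = sets borel"
    and annulus: "\<And>h. h0 \<le> h \<Longrightarrow> \<kappa> \<le> h ^ CARD('d::finite) * measure nu {h<..2 * h}"
    and h0: "0 < h0" and n: "0 < n"
    and g: "0 < g" "g \<le> \<kappa> / (2 * real CARD('d)) ^ CARD('d)"
    and e: "0 \<le> e" "e \<le> a" "g \<le> real CARD('d) + e"
  shows "EDout TYPE('d) nu a n \<le>
    ennreal (real CARD('d) powr a * 2 ^ CARD('d) * 2 powr g * real n powr (a - e)) *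
    ((\<integral>\<^sup>+ t. ennreal (max t h0 powr g) \<partial>nu) * (\<integral>\<^sup>+ t. ennreal (max t h0 powr (real CARD('d) + e - g)) \<partial>nu))"
proof -
  note [measurable_cong] = sets_nu
  let ?d = "real CARD('d)"
  let ?C = "?d powr a * 2 ^ CARD('d) * 2 powr g"
  let ?I = "\<integral>\<^sup>+ t. ennreal (max t h0 powr g) \<partial>nu"
  have "ppp_expect n nu (\<lambda>xs::((real^'d) \<times> real) list. Dout n a R xs) \<le>
      ennreal (?C * real n powr (a - e)) * ?I * ennreal (max R h0 powr (?d + e - g))" for R
  proof (cases "0 < R")
    case True
    let ?R = "min R (real n)"
    have "?d + a - g = (a - e) + (?d + e - g)" by simp
    then have "?R powr (?d + a - g) = ?R powr (a - e) * ?R powr (?d + e - g)"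
      using True n by (simp only: powr_add_real min_less_iff_conj of_nat_0_less_iff)
    also have "\<dots> \<le> real n powr (a - e) * max R h0 powr (?d + e - g)"
      using e g n True h0 by (intro mult_mono powr_mono2) auto
    finally have "?C * ?R powr (?d + a - g) \<le> ?C * (real n powr (a - e) * max R h0 powr (?d + e - g))"
      by (intro mult_left_mono) auto
    then have "ennreal (?C * ?R powr (?d + a - g)) * ?I \<le>
        ennreal (?C * (real n powr (a - e) * max R h0 powr (?d + e - g))) * ?I"
      by (intro mult_right_mono ennreal_leI) auto
    moreover have "ppp_expect n nu (\<lambda>xs::((real^'d) \<times> real) list. Dout n a R xs) \<le>
        ennreal (?C * ?R powr (?d + a - g)) * ?I"
      using e by (intro ppp_expect_Dout_le[OF prob sets_nu annulus h0 True n _ g]) auto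
    ultimately have "ppp_expect n nu (\<lambda>xs::((real^'d) \<times> real) list. Dout n a R xs) \<le>
        ennreal (?C * (real n powr (a - e) * max R h0 powr (?d + e - g))) * ?I"
      by (rule order_trans[rotated])
    also have "\<dots> = ennreal (?C * real n powr (a - e)) * ennreal (max R h0 powr (?d + e - g)) * ?I"
      by (subst ennreal_mult[symmetric]) (auto simp: mult.assoc)
    finally show ?thesis by (simp add: mult_ac)
  next
    case False
    \<comment> \<open>An edge needs a target mark in \<open>[0, R)\<close>, which is empty
      here.\<close>
    then have "Dout n a R xs = 0" for xs :: "((real^'d) \<times> real) list"
      by (auto simp: Dout_def thin_edge_def intro!: sum.neutral)
    then show ?thesis by (simp add: ppp_expect_def)
  qed
  then have "EDout TYPE('d) nu a n \<le>
     (\<integral>\<^sup>+ R. ennreal (?C * real n powr (a - e)) * ?I * ennreal (max R h0 powr (?d + e - g)) \<partial>nu)"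
    unfolding EDout_def by (intro nn_integral_mono)
  also have "\<dots> = ennreal (?C * real n powr (a - e)) * ?I * (\<integral>\<^sup>+ R. ennreal (max R h0 powr (?d + e - g)) \<partial>nu)"
    by (intro nn_integral_cmult) measurable
  finally show ?thesis by (simp add: mult.assoc)
qed

text \<open>Both mark moments have order below \<open>d\<close>: one by \<open>g < d\<close>, the
  other, of order \<open>d + e - g\<close>, by \<open>e < g\<close>. They are finite and join the
  constant.\<close>

lemma EDout_eventually_le:
  assumes prob: "prob_space nu" and sets_nu: "sets nu = sets borel"
    and h0: "0 < h0" and tail: "\<And>h. h0 \<le> h \<Longrightarrow> h ^ CARD('d::finite) * measure nu {h<..} \<le> K"
    and annulus: "\<And>h. h0 \<le> h \<Longrightarrow> \<kappa> \<le> h ^ CARD('d) * measure nu {h<..2 * h}"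
    and ge: "0 < g" "g \<le> \<kappa> / (2 * real CARD('d)) ^ CARD('d)" "g < real CARD('d)"
      "0 \<le> e" "e < g" "e \<le> a"
  shows "\<exists>C. \<forall>\<^sub>F n in sequentially. EDout TYPE('d) nu a n \<le> ennreal (C * real n powr (a - e))"
proof -
  let ?d = "real CARD('d)"
  have moment: "(\<integral>\<^sup>+ t. ennreal (max t h0 powr p) \<partial>nu) < \<infinity>" if "0 \<le> p" "p < ?d" for p
    using moment_finite_of_tail_bound[OF prob sets_nu h0 tail that] .
  define I where "I = (\<integral>\<^sup>+ t. ennreal (max t h0 powr g) \<partial>nu) * (\<integral>\<^sup>+ t. ennreal (max t h0 powr (?d + e - g)) \<partial>nu)"
  have "I < \<infinity>"
    unfolding I_def using ge moment[of g] moment[of "?d + e - g"] by (simp add: ennreal_mult_less_top)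
  then have I: "I = ennreal (enn2real I)" by simp
  let ?C = "?d powr a * 2 ^ CARD('d) * 2 powr g"
  have "EDout TYPE('d) nu a n \<le> ennreal (?C * enn2real I * real n powr (a - e))" if "0 < n" for n
  proof -
    have "EDout TYPE('d) nu a n \<le> ennreal (?C * real n powr (a - e)) * I"
      unfolding I_def using ge by (intro EDout_le[OF prob sets_nu annulus h0 that]) auto
    also have "\<dots> = ennreal (?C * enn2real I * real n powr (a - e))"
      by (subst I, subst ennreal_mult[symmetric]) (auto simp: mult_ac)
    finally show ?thesis .
  qed
  then show ?thesis
    by (intro exI[of _ "?C * enn2real I"] eventually_mono[OF eventually_gt_at_top[of 0]]) auto
qed

section \<open>Choice of the exponents\<close>

theorem theorem2p7:
  fixes nu :: "real measure" and \<beta> :: real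
  assumes "CARD('d::finite) \<ge> 2"
    and "prob_space nu" and "sets nu = sets borel"
    and "AE r in nu. 0 \<le> r"
    and "absolutely_continuous lborel nu"
    and "\<beta> > 0"
    and "((\<lambda>h::real. h ^ CARD('d) * measure nu {h<..}) \<longlongrightarrow> \<beta>) at_top"
  shows "(\<exists>C::real. \<forall>\<^sub>F n in sequentially. (EDout TYPE('d) nu 0 n :: ennreal) \<le> ennreal C)
         \<and> (\<forall>a>0. \<exists>\<delta>>0. \<exists>C::real. \<forall>\<^sub>F n in sequentially.
              (EDout TYPE('d) nu a n :: ennreal) \<le> ennreal (C * real n powr (a - \<delta>)))"
proof -
  let ?d = "real CARD('d)"
  obtain h0 where h0: "1 \<le> h0" "\<And>h. h0 \<le> h \<Longrightarrow> h ^ CARD('d) * measure nu {h<..} \<le> 2 * \<beta>"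
    "\<And>h. h0 \<le> h \<Longrightarrow> \<beta> / 4 \<le> h ^ CARD('d) * measure nu {h<..2 * h}"
    using tail_annulus_bound[OF assms(2,3,1,6,7)] by blast
  have h0': "0 < h0" using h0(1) by simp
  have d1: "1 < real CARD('d)" using assms(1) by simp
  let ?g = "\<beta> / 4 / (2 * ?d) ^ CARD('d)"
  have g0: "0 < ?g" using assms(6) by simp
  have bound: "\<exists>C. \<forall>\<^sub>F n in sequentially. EDout TYPE('d) nu a n \<le> ennreal (C * real n powr (a - e))"
    if "0 < g" "g \<le> ?g" "g < ?d" "0 \<le> e" "e < g" "e \<le> a" for a g e
    by (rule EDout_eventually_le[OF assms(2,3) h0' h0(2) h0(3) that])
  show ?thesis
  proof (intro conjI allI impI)
    \<comment> \<open>For the unweighted degree \<open>e = 0\<close> already gives a bounded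
      expectation; the cap at 1 ensures \<open>g < d\<close>.\<close>
    have "0 < min ?g 1" using g0 unfolding min_less_iff_conj by (intro conjI zero_less_one)
    then obtain C where C: "\<forall>\<^sub>F n in sequentially. EDout TYPE('d) nu 0 n \<le> ennreal (C * real n powr (0 - 0))"
      using bound[of "min ?g 1" 0 0, OF _ min.cobounded1 min.strict_coboundedI2[OF d1] order_refl _ order_refl] by blast
    have "\<forall>\<^sub>F n in sequentially. EDout TYPE('d) nu 0 n \<le> ennreal C"
      using C eventually_gt_at_top[of 0]
    proof eventually_elim
      case (elim n)
      then show ?case
        using powr_realpow[of "real n" 0] by (simp del: powr_zero_eq_one powr_eq_0_iff)
    qed
    then show "\<exists>C. \<forall>\<^sub>F n in sequentially. EDout TYPE('d) nu 0 n \<le> ennreal C" by blast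
  next
    fix a :: real assume "0 < a"
    \<comment> \<open>The cap at \<open>a\<close> makes \<open>e = g / 2\<close> at most
      \<open>a\<close>, and halving makes it strictly less than \<open>g\<close>; this
      \<open>e\<close> serves as \<open>\<delta>\<close>.\<close>
    define g where "g = min ?g (min 1 a)"
    have "0 < g"
      using g0 \<open>0 < a\<close> unfolding g_def min_less_iff_conj by (intro conjI zero_less_one)
    moreover have "g \<le> ?g" unfolding g_def by (rule min.cobounded1)
    moreover have "g < ?d" unfolding g_def by (rule min.strict_coboundedI2[OF min.strict_coboundedI1[OF d1]])
    moreover have "g \<le> a" unfolding g_def by (rule min.coboundedI2[OF min.cobounded2])
    ultimately have g: "0 < g" "g \<le> ?g" "g < ?d" "0 \<le> g / 2" "g / 2 < g" "g / 2 \<le> a"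
      by simp_all
    show "\<exists>\<delta>>0. \<exists>C. \<forall>\<^sub>F n in sequentially. EDout TYPE('d) nu a n \<le> ennreal (C * real n powr (a - \<delta>))"
      using bound[OF g] g(1) by (intro exI[of _ "g / 2"]) auto
  qed
qed

end
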